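(* Let $n \ge 2$ be an integer and let $q = 2^{2^n}$. Then there exist a word $w$ in the free group $F_2$ of rank two and an equivalence class $C$ of elements of order $17$ in $\mathrm{SL}_2(q)$ such that $\mathrm{SL}_2(q)_w = \{e\} \cup C$, i.e. $\mathrm{SL}_2(q)_w$ consists of the identity and a single equivalence class of elements of order $17$.
   Context: A word is an element of a free group. For a group $G$ and a word $w$ in the free group of rank $k$, $G_w := \{ w(g_1,\dots,g_k)^{\pm 1} \mid g_i \in G\}$ denotes the set of word values. An equivalence class in a group $G$ is an orbit of the automorphism group $\mathrm{Aut}(G)$ acting on $G$ (hence a union of conjugacy classes). $\mathrm{SL}_2(q)$ is the group of $2\times 2$ matrices of determinant $1$ over the finite field $\mathbb{F}_q$, and $e$ denotes its identity element. *)

theory Defs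
  imports "HOL-Analysis.Determinants" "HOL-Algebra.Group_Action" "HOL-Algebra.Multiplicative_Group"
begin

section \<open>Free groups\<close>

text \<open>A letter \<open>(i, False)\<close> stands for the generator \<open>x\<^sub>i\<close>, and \<open>(i, True)\<close> for its inverse.
  An element of the free group on \<open>S\<close> is represented by its unique reduced word.\<close>

type_synonym 'x letter = "'x \<times> bool"

definition inv_letter :: "'x letter \<Rightarrow> 'x letter" where
  "inv_letter a = (fst a, \<not> snd a)"

fun reduced :: "'x letter list \<Rightarrow> bool" where
  "reduced (a # b # u) \<longleftrightarrow> b \<noteq> inv_letter a \<and> reduced (b # u)"
| "reduced _ \<longleftrightarrow> True"

fun cons_reduce :: "'x letter \<Rightarrow> 'x letter list \<Rightarrow> 'x letter list" where
  "cons_reduce a [] = [a]"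
| "cons_reduce a (b # u) = (if b = inv_letter a then u else a # b # u)"

text \<open>The product of two reduced words is their concatenation followed by free cancellation;
  \<open>foldr\<close> performs both at once.\<close>

definition free_group :: "'x set \<Rightarrow> 'x letter list monoid" where
  "free_group S =
     \<lparr>carrier = {u. reduced u \<and> set u \<subseteq> S \<times> UNIV},
      mult = (\<lambda>u v. foldr cons_reduce u v),
      one = []\<rparr>"

definition free_group_rank :: "nat \<Rightarrow> nat letter list monoid" where
  "free_group_rank k = free_group {..<k}"

lemma inv_letter_inv_letter [simp]: "inv_letter (inv_letter a) = a"
  by (simp add: inv_letter_def)

lemma inv_letter_neq [simp]: "inv_letter a \<noteq> a" "a \<noteq> inv_letter a"
  by (metis inv_letter_def snd_conv)+

lemma reduced_ConsD: "reduced (a # u) \<Longrightarrow> reduced u"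
  by (cases u) auto

lemma reduced_cons_reduce: "reduced u \<Longrightarrow> reduced (cons_reduce a u)"
  by (cases u) (auto dest: reduced_ConsD)

lemma cons_reduce_cancel: "reduced u \<Longrightarrow> cons_reduce (inv_letter a) (cons_reduce a u) = u"
  by (cases u; cases "tl u") auto

lemma cons_reduce_cancel': "reduced u \<Longrightarrow> cons_reduce a (cons_reduce (inv_letter a) u) = u"
  using cons_reduce_cancel[of u "inv_letter a"] by simp

lemma reduced_foldr: "reduced v \<Longrightarrow> reduced (foldr cons_reduce u v)"
  by (induction u) (auto intro: reduced_cons_reduce)

lemma foldr_cons_reduce_Nil: "reduced u \<Longrightarrow> foldr cons_reduce u [] = u"
proof (induction u)
  case (Cons a u)
  then show ?case by (cases u) auto
qed simp

lemma set_cons_reduce: "set (cons_reduce a u) \<subseteq> insert a (set u)"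
  by (cases u) auto

lemma set_foldr_cons_reduce: "set (foldr cons_reduce u v) \<subseteq> set u \<union> set v"
proof (induction u)
  case (Cons a u)
  then show ?case using set_cons_reduce[of a "foldr cons_reduce u v"] by auto
qed simp

lemma foldr_cons_reduce_step:
  "reduced w \<Longrightarrow>
     foldr cons_reduce (cons_reduce a u) w = cons_reduce a (foldr cons_reduce u w)"
  by (cases u) (auto simp: cons_reduce_cancel' reduced_foldr)

lemma foldr_cons_reduce_assoc:
  "reduced w \<Longrightarrow>
     foldr cons_reduce (foldr cons_reduce u v) w = foldr cons_reduce u (foldr cons_reduce v w)"
  by (induction u) (auto simp: foldr_cons_reduce_step)

lemma foldr_cons_reduce_inv:
  "reduced v \<Longrightarrow> foldr cons_reduce (rev (map inv_letter u)) (foldr cons_reduce u v) = v"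
  by (induction u arbitrary: v) (auto simp: cons_reduce_cancel reduced_foldr)

lemma group_free_group: "group (free_group S)"
proof (rule groupI)
  fix u assume u: "u \<in> carrier (free_group S)"
  let ?v = "foldr cons_reduce (rev (map inv_letter u)) []"
  have "set ?v \<subseteq> inv_letter ` set u"
    using set_foldr_cons_reduce[of "rev (map inv_letter u)" "[]"] by simp
  moreover have "inv_letter ` set u \<subseteq> S \<times> UNIV"
    using u by (force simp: free_group_def inv_letter_def)
  ultimately have "?v \<in> carrier (free_group S)"
    by (simp add: free_group_def reduced_foldr)
  moreover have "?v \<otimes>\<^bsub>free_group S\<^esub> u = \<one>\<^bsub>free_group S\<^esub>"
    using u foldr_cons_reduce_inv[of "[]" u]
    by (simp add: free_group_def foldr_cons_reduce_assoc foldr_cons_reduce_Nil)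
  ultimately show "\<exists>v\<in>carrier (free_group S). v \<otimes>\<^bsub>free_group S\<^esub> u = \<one>\<^bsub>free_group S\<^esub>"
    by blast
qed (use set_foldr_cons_reduce in
      \<open>fastforce simp: free_group_def reduced_foldr foldr_cons_reduce_assoc\<close>)+


section \<open>Word values\<close>

definition letter_value :: "('g, 'm) monoid_scheme \<Rightarrow> ('x \<Rightarrow> 'g) \<Rightarrow> 'x letter \<Rightarrow> 'g" where
  "letter_value G g a = (if snd a then inv\<^bsub>G\<^esub> (g (fst a)) else g (fst a))"

text \<open>\<open>w(g\<^sub>0, g\<^sub>1, \<dots>)\<close>: substitute \<open>g i\<close> for the generator \<open>x\<^sub>i\<close>. This is the
  homomorphism from the free group that sends \<open>x\<^sub>i\<close> to \<open>g i\<close>; see \<open>word_eval_hom\<close> and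
  \<open>word_eval_generator\<close> below.\<close>

definition word_eval :: "('g, 'm) monoid_scheme \<Rightarrow> ('x \<Rightarrow> 'g) \<Rightarrow> 'x letter list \<Rightarrow> 'g" where
  "word_eval G g w = foldr (\<lambda>a h. letter_value G g a \<otimes>\<^bsub>G\<^esub> h) w \<one>\<^bsub>G\<^esub>"

definition word_values :: "('g, 'm) monoid_scheme \<Rightarrow> nat \<Rightarrow> nat letter list \<Rightarrow> 'g set" where
  "word_values G k w =
     (\<Union>g \<in> {..<k} \<rightarrow> carrier G. {word_eval G g w, inv\<^bsub>G\<^esub> (word_eval G g w)})"

lemma generator_in_free_group: "i \<in> S \<Longrightarrow> [(i, b)] \<in> carrier (free_group S)"
  by (simp add: free_group_def)

context group
begin

lemma letter_value_closed:
  "g \<in> S \<rightarrow> carrier G \<Longrightarrow> fst a \<in> S \<Longrightarrow> letter_value G g a \<in> carrier G"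
  by (auto simp: letter_value_def)

lemma word_eval_generator: "g i \<in> carrier G \<Longrightarrow> word_eval G g [(i, False)] = g i"
  by (simp add: word_eval_def letter_value_def)

lemma word_eval_closed:
  assumes "g \<in> S \<rightarrow> carrier G" "set u \<subseteq> S \<times> UNIV"
  shows "word_eval G g u \<in> carrier G"
  using assms(2) by (induction u) (auto simp: word_eval_def intro!: letter_value_closed[OF assms(1)])

lemma word_eval_cons_reduce:
  assumes g: "g \<in> S \<rightarrow> carrier G" and "set (a # u) \<subseteq> S \<times> UNIV"
  shows "word_eval G g (cons_reduce a u) = letter_value G g a \<otimes> word_eval G g u"
proof (cases "\<exists>v. u = inv_letter a # v")
  case True
  then obtain v where u: "u = inv_letter a # v" by blast
  have cl: "g (fst a) \<in> carrier G" "word_eval G g v \<in> carrier G"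
    using assms u word_eval_closed[OF g, of v] by auto
  have "letter_value G g a \<otimes> letter_value G g (inv_letter a) = \<one>"
    using cl by (auto simp: letter_value_def inv_letter_def)
  moreover have "letter_value G g a \<in> carrier G" "letter_value G g (inv_letter a) \<in> carrier G"
    using cl by (auto simp: letter_value_def inv_letter_def)
  ultimately have "letter_value G g a \<otimes> (letter_value G g (inv_letter a) \<otimes> word_eval G g v)
      = word_eval G g v"
    using cl by (simp flip: m_assoc)
  then show ?thesis by (simp add: u word_eval_def)
next
  case False
  then show ?thesis by (cases u) (auto simp: word_eval_def)
qed

lemma word_eval_hom:
  assumes g: "g \<in> S \<rightarrow> carrier G"
  shows "word_eval G g \<in> hom (free_group S) G"
proof (rule homI)
  fix u v assume "u \<in> carrier (free_group S)" "v \<in> carrier (free_group S)"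
  then have uv: "set u \<subseteq> S \<times> UNIV" "set v \<subseteq> S \<times> UNIV"
    by (auto simp: free_group_def)
  have "word_eval G g (foldr cons_reduce u v) = word_eval G g u \<otimes> word_eval G g v"
    using uv(1)
  proof (induction u)
    case Nil
    then show ?case using word_eval_closed[OF g uv(2)] by (simp add: word_eval_def)
  next
    case (Cons a u)
    have sub: "set (a # foldr cons_reduce u v) \<subseteq> S \<times> UNIV"
      using Cons.prems uv(2) set_foldr_cons_reduce[of u v] by fastforce
    have "letter_value G g a \<in> carrier G"
      using Cons.prems by (auto intro!: letter_value_closed[OF g])
    then show ?case
      using Cons word_eval_closed[OF g, of u] word_eval_closed[OF g uv(2)]
        word_eval_cons_reduce[OF g sub]
      by (simp add: word_eval_def m_assoc)
  qed
  then show "word_eval G g (u \<otimes>\<^bsub>free_group S\<^esub> v) = word_eval G g u \<otimes> word_eval G g v"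
    by (simp add: free_group_def)
qed (auto simp: free_group_def intro!: word_eval_closed[OF g])

end


section \<open>Equivalence classes\<close>

definition equivalence_class :: "('g, 'm) monoid_scheme \<Rightarrow> 'g set \<Rightarrow> bool" where
  "equivalence_class G C \<longleftrightarrow> (\<exists>x \<in> carrier G. C = orbit (AutoGroup G) (\<lambda>\<phi>. \<phi>) x)"


section \<open>The group of two-by-two matrices of determinant one\<close>

definition SL2 :: "'a::field itself \<Rightarrow> ('a^2^2) monoid" where
  "SL2 _ = \<lparr>carrier = {A. det A = 1}, mult = (**), one = mat 1\<rparr>"

lemma group_SL2: "group (SL2 TYPE('a::field))"
proof (rule groupI)
  fix A assume "A \<in> carrier (SL2 TYPE('a))"
  then have dA: "det A = 1" by (simp add: SL2_def)
  then obtain B where B: "B ** A = mat 1"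
    by (metis invertible_det_nz invertible_def zero_neq_one)
  then have "det B * det A = 1" by (metis det_mul det_I)
  with dA B show "\<exists>B\<in>carrier (SL2 TYPE('a)). B \<otimes>\<^bsub>SL2 TYPE('a)\<^esub> A = \<one>\<^bsub>SL2 TYPE('a)\<^esub>"
    by (auto simp: SL2_def)
qed (auto simp: SL2_def det_mul matrix_mul_assoc)

end

theory Submission
  imports Defs "HOL-Algebra.SimpleGroups" "HOL-Algebra.Algebraic_Closure_Type"
    "HOL-Number_Theory.Residues"
begin

text \<open>
  The statement is an instance of a general fact (\<open>word_image_eq_orbit\<close>). Let \<open>G\<close> be a finite
  nonabelian simple group generated by a tuple \<open>g\<^sub>0\<close>, and let \<open>c \<in> G\<close> be arbitrary. Then some word
  takes on \<open>G\<close> exactly the values in the automorphism orbit of \<open>c\<close>, together with the identity.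

  To see this, regard every tuple \<open>g\<close> as the substitution homomorphism \<open>F \<rightarrow> G\<close> on the free group.
  Let \<open>M\<close> be the kernel at \<open>g\<^sub>0\<close>, so \<open>F/M\<close> is \<open>G\<close>. If the kernel at \<open>g\<close> is contained in \<open>M\<close>, then
  comparing orders shows that the two kernels agree and that \<open>g\<close> is the image of \<open>g\<^sub>0\<close> under an
  automorphism (\<open>auto_of_kernel_subset\<close>). All the other tuples have kernels not contained in \<open>M\<close>,
  and there are only finitely many of these kernels. Since \<open>F/M\<close> is nonabelian simple, \<open>M\<close> behaves
  like a prime ideal, with commutators in the role of products: the intersection of the other
  kernels is not contained in \<open>M\<close> either, hence it maps onto \<open>G\<close>
  (\<open>prescribe_value_killing_homs\<close>). So there is a word \<open>w\<close> with value \<open>c\<close> at \<open>g\<^sub>0\<close>, with value \<open>1\<close> at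
  every tuple of the second kind, and therefore with value \<open>\<phi> c\<close> at every tuple \<open>\<phi> g\<^sub>0\<close>.

  It remains to know four things about \<open>SL\<^sub>2(q)\<close> for \<open>q = 2 ^ 2 ^ n\<close> with \<open>n \<ge> 2\<close>. It is simple and
  nonabelian, being a special linear group over a field of characteristic two with more than two
  elements. It is generated by the diagonal matrix of a primitive element together with one further
  matrix. It contains an element of order \<open>17\<close>: as \<open>q\<close> is a power of \<open>16\<close>, the field has a
  primitive fifth root of unity \<open>t\<close>, and every matrix of determinant \<open>1\<close> and trace \<open>t\<close> has order
  \<open>17\<close>. Finally this element is conjugate to its inverse, so that closing the set of word values
  under inversion adds nothing.
\<close>

section \<open>Prescribing the values of a word on a simple group\<close>

text \<open>The center is normal, and it is not the whole group.\<close>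

lemma (in simple_group) commutes_with_all_imp_one:
  assumes "\<not> comm_group G" and "x \<in> carrier G"
    and "\<And>y. y \<in> carrier G \<Longrightarrow> x \<otimes> y = y \<otimes> x"
  shows "x = \<one>"
proof -
  let ?Z = "{z \<in> carrier G. \<forall>y\<in>carrier G. z \<otimes> y = y \<otimes> z}"
  have "subgroup ?Z G"
  proof (rule subgroupI)
    fix a assume a: "a \<in> ?Z"
    have "inv a \<otimes> y = y \<otimes> inv a" if y: "y \<in> carrier G" for y
    proof -
      have "inv a \<otimes> y = inv a \<otimes> (y \<otimes> a) \<otimes> inv a"
        using a y by (simp add: m_assoc)
      also have "\<dots> = inv a \<otimes> (a \<otimes> y) \<otimes> inv a" using a y by simp
      also have "\<dots> = y \<otimes> inv a" using a y by (simp add: inv_solve_left' m_assoc)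
      finally show ?thesis .
    qed
    then show "inv a \<in> ?Z" using a by auto
  next
    fix a b assume a: "a \<in> ?Z" and b: "b \<in> ?Z"
    have "a \<otimes> b \<otimes> y = y \<otimes> (a \<otimes> b)" if y: "y \<in> carrier G" for y
    proof -
      have cl: "a \<in> carrier G" "b \<in> carrier G" and comm: "a \<otimes> y = y \<otimes> a" "b \<otimes> y = y \<otimes> b"
        using a b y by blast+
      have "a \<otimes> b \<otimes> y = a \<otimes> (y \<otimes> b)" using cl y by (simp add: m_assoc comm(2))
      also have "\<dots> = a \<otimes> y \<otimes> b" using cl y by (simp add: m_assoc)
      also have "\<dots> = y \<otimes> (a \<otimes> b)" using cl y by (simp add: m_assoc comm(1))
      finally show ?thesis .
    qed
    then show "a \<otimes> b \<in> ?Z" using a b m_closed by blast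
  qed (auto intro: exI[of _ \<one>])
  moreover have "y \<otimes> z \<otimes> inv y \<in> ?Z" if "y \<in> carrier G" "z \<in> ?Z" for y z
  proof -
    have "z \<in> carrier G" "y \<otimes> z = z \<otimes> y" using that by auto
    then have "y \<otimes> z \<otimes> inv y = z" using that(1) by (simp add: m_assoc)
    with that show ?thesis by simp
  qed
  ultimately have "?Z \<lhd> G" by (simp add: normal_inv_iff)
  then consider "?Z = carrier G" | "?Z = {\<one>}" using no_real_normal_subgroup by blast
  then show ?thesis
  proof cases
    case 1
    then have "comm_group G" by (intro group_comm_groupI) blast
    with assms(1) show ?thesis by simp
  next
    case 2
    with assms(2,3) show ?thesis by blast
  qed
qed

lemma (in simple_group) normal_eq_carrierI:
  assumes "N \<lhd> G" "x \<in> N" "x \<noteq> \<one>"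
  shows "N = carrier G"
  using no_real_normal_subgroup[OF assms(1)] assms(2,3) by blast

text \<open>The primeness property: if no single kernel of the \<open>f \<in> I\<close> lies in \<open>ker h\<close>, then neither does
  their intersection, and \<open>h\<close> even maps it onto \<open>G\<close>. By induction on \<open>I\<close>. The image under \<open>h\<close> of the
  common kernel is normal in \<open>G\<close>, so one nontrivial element in it suffices. For that, take \<open>u\<close> in the
  kernel of the new \<open>f\<close> with \<open>h u \<noteq> 1\<close>, choose \<open>y \<in> G\<close> not commuting with \<open>h u\<close>, and lift \<open>y\<close> to
  some \<open>v\<close> in the kernels of the old ones; the commutator of \<open>u\<close> and \<open>v\<close> lies in all kernels.\<close>

lemma prescribe_value_killing_homs:
  assumes F: "group F" and K: "group K" and G: "simple_group G" "\<not> comm_group G"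
    and h: "h \<in> hom F G" "h ` carrier F = carrier G"
    and I: "finite I" "I \<subseteq> hom F K"
    and avoid: "\<And>f. f \<in> I \<Longrightarrow> \<exists>u\<in>carrier F. f u = \<one>\<^bsub>K\<^esub> \<and> h u \<noteq> \<one>\<^bsub>G\<^esub>"
    and c: "c \<in> carrier G"
  shows "\<exists>w\<in>carrier F. h w = c \<and> (\<forall>f\<in>I. f w = \<one>\<^bsub>K\<^esub>)"
  using I avoid c
proof (induction I arbitrary: c rule: finite_induct)
  case empty
  then have "c \<in> h ` carrier F" using h(2) by simp
  then show ?case by auto
next
  case (insert f I)
  interpret F: group F by (rule F)
  interpret K: group K by (rule K)
  interpret G: simple_group G by (rule G(1))
  interpret h: group_hom F G h by (unfold_locales) (rule h(1))
  have hom: "group_hom F K k" if "k \<in> insert f I" for k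
    using insert.prems(1) that F K by (auto simp: group_hom_def group_hom_axioms_def)
  let ?W = "{w \<in> carrier F. \<forall>k\<in>insert f I. k w = \<one>\<^bsub>K\<^esub>}"
  have sub: "subgroup ?W F"
  proof (rule F.subgroupI)
    show "?W \<noteq> {}" using hom[THEN group_hom.hom_one] by blast
    show "inv\<^bsub>F\<^esub> a \<in> ?W" if "a \<in> ?W" for a
    proof -
      have "k (inv\<^bsub>F\<^esub> a) = \<one>\<^bsub>K\<^esub>" if "k \<in> insert f I" for k
        using group_hom.hom_inv[OF hom[OF that], of a] \<open>a \<in> ?W\<close> that by auto
      with that show ?thesis by auto
    qed
    show "a \<otimes>\<^bsub>F\<^esub> b \<in> ?W" if "a \<in> ?W" "b \<in> ?W" for a b
    proof -
      have "k (a \<otimes>\<^bsub>F\<^esub> b) = \<one>\<^bsub>K\<^esub>" if "k \<in> insert f I" for k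
      proof -
        have "a \<in> carrier F" "b \<in> carrier F" "k a = \<one>\<^bsub>K\<^esub>" "k b = \<one>\<^bsub>K\<^esub>"
          using \<open>a \<in> ?W\<close> \<open>b \<in> ?W\<close> that by blast+
        then show ?thesis by (simp add: group_hom.hom_mult[OF hom[OF that]])
      qed
      with that show ?thesis by auto
    qed
  qed auto
  have nrm: "x \<otimes>\<^bsub>F\<^esub> w \<otimes>\<^bsub>F\<^esub> inv\<^bsub>F\<^esub> x \<in> ?W" if "x \<in> carrier F" "w \<in> ?W" for x w
  proof -
    have "k (x \<otimes>\<^bsub>F\<^esub> w \<otimes>\<^bsub>F\<^esub> inv\<^bsub>F\<^esub> x) = \<one>\<^bsub>K\<^esub>" if k: "k \<in> insert f I" for k
    proof -
      interpret k: group_hom F K k by (rule hom[OF k])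
      have "w \<in> carrier F" "k w = \<one>\<^bsub>K\<^esub>" using k \<open>w \<in> ?W\<close> by blast+
      then show ?thesis using \<open>x \<in> carrier F\<close> by simp
    qed
    with that show ?thesis by auto
  qed
  have "h ` ?W \<lhd> G"
    unfolding G.normal_inv_iff
  proof (intro conjI ballI)
    show "subgroup (h ` ?W) G" using h.subgroup_img_is_subgroup[OF sub] .
    fix y z assume "y \<in> carrier G" "z \<in> h ` ?W"
    then obtain x w where xw: "x \<in> carrier F" "y = h x" "w \<in> ?W" "z = h w"
      using h(2) by blast
    then have "y \<otimes>\<^bsub>G\<^esub> z \<otimes>\<^bsub>G\<^esub> inv\<^bsub>G\<^esub> y = h (x \<otimes>\<^bsub>F\<^esub> w \<otimes>\<^bsub>F\<^esub> inv\<^bsub>F\<^esub> x)" by simp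
    with nrm[OF xw(1,3)] show "y \<otimes>\<^bsub>G\<^esub> z \<otimes>\<^bsub>G\<^esub> inv\<^bsub>G\<^esub> y \<in> h ` ?W" by blast
  qed
  moreover obtain u where u: "u \<in> carrier F" "f u = \<one>\<^bsub>K\<^esub>" "h u \<noteq> \<one>\<^bsub>G\<^esub>"
    using insert.prems(2) by blast
  obtain y where y: "y \<in> carrier G" "h u \<otimes>\<^bsub>G\<^esub> y \<noteq> y \<otimes>\<^bsub>G\<^esub> h u"
    using G.commutes_with_all_imp_one[OF G(2), of "h u"] u by auto
  obtain v where v: "v \<in> carrier F" "h v = y" "\<forall>k\<in>I. k v = \<one>\<^bsub>K\<^esub>"
    using insert.IH[of y] insert.prems y(1) by auto
  define w where "w = u \<otimes>\<^bsub>F\<^esub> v \<otimes>\<^bsub>F\<^esub> inv\<^bsub>F\<^esub> u \<otimes>\<^bsub>F\<^esub> inv\<^bsub>F\<^esub> v"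
  have "w \<in> ?W"
  proof -
    have "k w = \<one>\<^bsub>K\<^esub>" if k: "k \<in> insert f I" for k
    proof -
      interpret k: group_hom F K k by (rule hom[OF k])
      from k u v have "k u = \<one>\<^bsub>K\<^esub> \<or> k v = \<one>\<^bsub>K\<^esub>" by blast
      then show ?thesis using u(1) v(1) by (auto simp: w_def)
    qed
    then show ?thesis using u v by (auto simp: w_def)
  qed
  moreover have "h w \<noteq> \<one>\<^bsub>G\<^esub>"
  proof
    assume "h w = \<one>\<^bsub>G\<^esub>"
    then have "h u \<otimes>\<^bsub>G\<^esub> y \<otimes>\<^bsub>G\<^esub> inv\<^bsub>G\<^esub> (y \<otimes>\<^bsub>G\<^esub> h u) = \<one>\<^bsub>G\<^esub>"
      using u(1) v(1,2) y(1) by (simp add: w_def G.inv_mult_group G.m_assoc)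
    then show False
      using y u(1) by (metis G.inv_equality G.inv_inv G.m_closed G.inv_closed h.hom_closed)
  qed
  ultimately have "h ` ?W = carrier G"
    using G.normal_eq_carrierI by blast
  with insert.prems(3) have "c \<in> h ` ?W" by simp
  then show ?case by blast
qed

text \<open>The kernel condition gives a surjection \<open>\<psi>\<close> from the image of \<open>f\<close> onto \<open>G\<close> with \<open>\<psi> \<circ> f = h\<close>.
  As \<open>G\<close> is finite, the image of \<open>f\<close> must then be all of \<open>G\<close> and \<open>\<psi>\<close> must be injective; the
  automorphism is the inverse of \<open>\<psi>\<close>.\<close>

lemma auto_of_kernel_subset:
  assumes F: "group F" and G: "group G" "finite (carrier G)"
    and h: "h \<in> hom F G" "h ` carrier F = carrier G"
    and f: "f \<in> hom F G"
    and ker: "\<And>u. u \<in> carrier F \<Longrightarrow> f u = \<one>\<^bsub>G\<^esub> \<Longrightarrow> h u = \<one>\<^bsub>G\<^esub>"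
  shows "\<exists>\<phi>\<in>auto G. \<forall>u\<in>carrier F. f u = \<phi> (h u)"
proof -
  interpret F: group F by (rule F)
  interpret G: group G by (rule G(1))
  interpret h: group_hom F G h by (unfold_locales) (rule h(1))
  interpret f: group_hom F G f by (unfold_locales) (rule f)
  have hf: "h u = h v" if uv: "u \<in> carrier F" "v \<in> carrier F" "f u = f v" for u v
  proof -
    have "f (u \<otimes>\<^bsub>F\<^esub> inv\<^bsub>F\<^esub> v) = \<one>\<^bsub>G\<^esub>" using uv by simp
    then have "h (u \<otimes>\<^bsub>F\<^esub> inv\<^bsub>F\<^esub> v) = \<one>\<^bsub>G\<^esub>" using ker uv by simp
    then have "h u \<otimes>\<^bsub>G\<^esub> inv\<^bsub>G\<^esub> h v = \<one>\<^bsub>G\<^esub>" using uv by simp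
    then show ?thesis using uv by (metis G.inv_equality G.inv_inv G.inv_closed h.hom_closed)
  qed
  define \<psi> where "\<psi> = h \<circ> inv_into (carrier F) f"
  have \<psi>: "\<psi> (f u) = h u" if "u \<in> carrier F" for u
  proof -
    have fu: "f u \<in> f ` carrier F" using that by simp
    show ?thesis
      unfolding \<psi>_def o_def by (rule hf[OF inv_into_into[OF fu] that f_inv_into_f[OF fu]])
  qed
  have fsub: "f ` carrier F \<subseteq> carrier G" by auto
  have \<psi>im: "\<psi> ` f ` carrier F = carrier G"
    using h(2) \<psi> by (force simp: image_image)
  have "card (carrier G) \<le> card (f ` carrier F)"
    by (metis \<psi>im card_image_le finite_subset[OF fsub G(2)])
  then have fsurj: "f ` carrier F = carrier G"
    by (intro card_subset_eq[OF G(2) fsub] le_antisym card_mono[OF G(2) fsub])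
  have inj: "inj_on \<psi> (carrier G)"
    by (rule eq_card_imp_inj_on[OF G(2)]) (use \<psi>im in \<open>simp add: fsurj\<close>)
  have fh: "f u = f v" if "u \<in> carrier F" "v \<in> carrier F" "h u = h v" for u v
    using inj_onD[OF inj, of "f u" "f v"] that \<psi> by simp
  \<comment> \<open>Restricted, because automorphisms are by definition extensional functions.\<close>
  define \<phi> where "\<phi> = restrict (f \<circ> inv_into (carrier F) h) (carrier G)"
  have \<phi>: "\<phi> (h u) = f u" if "u \<in> carrier F" for u
  proof -
    have hu: "h u \<in> h ` carrier F" using that by simp
    have "f (inv_into (carrier F) h (h u)) = f u"
      by (rule fh[OF inv_into_into[OF hu] that f_inv_into_f[OF hu]])
    then show ?thesis using that by (simp add: \<phi>_def)
  qed
  have "\<phi> ` h ` carrier F = f ` carrier F"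
    by (simp add: image_image \<phi> cong: image_cong_simp)
  then have img: "\<phi> ` carrier G = carrier G"
    by (simp add: h(2) fsurj)
  have "bij_betw \<phi> (carrier G) (carrier G)"
    unfolding bij_betw_def by (intro conjI eq_card_imp_inj_on[OF G(2)] img) (simp add: img)
  moreover have "\<phi> \<in> hom G G"
  proof (rule homI)
    show "\<phi> x \<in> carrier G" if "x \<in> carrier G" for x using img that by blast
    fix x y assume "x \<in> carrier G" "y \<in> carrier G"
    then obtain u v where "u \<in> carrier F" "v \<in> carrier F" "x = h u" "y = h v" using h(2) by blast
    then show "\<phi> (x \<otimes>\<^bsub>G\<^esub> y) = \<phi> x \<otimes>\<^bsub>G\<^esub> \<phi> y"
      using \<phi>[of "u \<otimes>\<^bsub>F\<^esub> v"] \<phi> by simp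
  qed
  ultimately have "\<phi> \<in> auto G"
    by (simp add: auto_def Bij_def \<phi>_def)
  with \<phi> show ?thesis by metis
qed

context group
begin

lemma word_eval_restrict:
  "set w \<subseteq> S \<times> UNIV \<Longrightarrow> word_eval G (restrict g S) w = word_eval G g w"
  by (induction w) (auto simp: word_eval_def letter_value_def)

lemma word_eval_one: "word_eval G (\<lambda>_. \<one>) w = \<one>"
  by (induction w) (auto simp: word_eval_def letter_value_def)

lemma word_eval_auto:
  assumes \<phi>: "\<phi> \<in> hom G G" and g: "g \<in> S \<rightarrow> carrier G" and w: "set w \<subseteq> S \<times> UNIV"
  shows "word_eval G (\<phi> \<circ> g) w = \<phi> (word_eval G g w)"
proof -
  interpret \<phi>: group_hom G G \<phi> by unfold_locales (rule \<phi>)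
  show ?thesis using w
  proof (induction w)
    case (Cons a w)
    then show ?case
      using word_eval_closed[OF g, of w] g
      by (auto simp: word_eval_def letter_value_def Pi_iff)
  qed (simp add: word_eval_def)
qed

lemma word_eval_surj:
  assumes g: "g \<in> S \<rightarrow> carrier G" and gen: "generate G (g ` S) = carrier G"
  shows "word_eval G g ` carrier (free_group S) = carrier G"
proof
  interpret F: group "free_group S" by (rule group_free_group)
  interpret e: group_hom "free_group S" G "word_eval G g"
    by unfold_locales (rule word_eval_hom[OF g])
  show "word_eval G g ` carrier (free_group S) \<subseteq> carrier G" by auto
  have "subgroup (word_eval G g ` carrier (free_group S)) G"
    by (rule e.img_is_subgroup)
  moreover have "g ` S \<subseteq> word_eval G g ` carrier (free_group S)"
  proof
    fix x assume "x \<in> g ` S"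
    then obtain i where i: "i \<in> S" "x = g i" by blast
    then have "x = word_eval G g [(i, False)]" using g by (subst word_eval_generator) auto
    then show "x \<in> word_eval G g ` carrier (free_group S)"
      using generator_in_free_group[OF i(1)] by blast
  qed
  ultimately show "carrier G \<subseteq> word_eval G g ` carrier (free_group S)"
    using generate_subgroup_incl gen by blast
qed

end

text \<open>The tuples whose kernel is contained in the kernel at \<open>g\<^sub>0\<close> contribute the orbit of \<open>c\<close>, and the word
  is trivial at all the others. The constant tuple \<open>1\<close> is one of these, so the identity is attained.\<close>

lemma word_image_eq_orbit:
  assumes G: "simple_group G" "\<not> comm_group G" "finite (carrier G)"
    and S: "finite S" and g\<^sub>0: "g\<^sub>0 \<in> S \<rightarrow> carrier G" "generate G (g\<^sub>0 ` S) = carrier G"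
    and c: "c \<in> carrier G"
  shows "\<exists>w\<in>carrier (free_group S).
           (\<lambda>g. word_eval G g w) ` (S \<rightarrow> carrier G) = insert \<one>\<^bsub>G\<^esub> (orbit (AutoGroup G) (\<lambda>\<phi>. \<phi>) c)"
proof -
  interpret G: simple_group G by (rule G(1))
  let ?F = "free_group S" and ?h = "word_eval G g\<^sub>0"
  \<comment> \<open>Extensional tuples only, because the index set has to be finite; a word cannot see the values outside \<open>S\<close>.\<close>
  let ?I = "{f \<in> word_eval G ` (S \<rightarrow>\<^sub>E carrier G).
               \<exists>u\<in>carrier ?F. f u = \<one>\<^bsub>G\<^esub> \<and> ?h u \<noteq> \<one>\<^bsub>G\<^esub>}"
  have "finite ?I" using S G(3) by (simp add: finite_PiE)
  moreover have "?I \<subseteq> hom ?F G"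
    using G.word_eval_hom by (auto simp: PiE_def)
  ultimately obtain w where w: "w \<in> carrier ?F" "?h w = c" "\<And>f. f \<in> ?I \<Longrightarrow> f w = \<one>\<^bsub>G\<^esub>"
    using prescribe_value_killing_homs[OF group_free_group G.is_group G(1,2) G.word_eval_hom[OF g\<^sub>0(1)]
        G.word_eval_surj[OF g\<^sub>0], of ?I c] c by blast
  have cF: "set u \<subseteq> S \<times> UNIV" if "u \<in> carrier ?F" for u
    using that by (simp add: free_group_def)
  have "word_eval G g w \<in> insert \<one>\<^bsub>G\<^esub> (orbit (AutoGroup G) (\<lambda>\<phi>. \<phi>) c)"
    if g: "g \<in> S \<rightarrow> carrier G" for g
  proof (cases "\<exists>u\<in>carrier ?F. word_eval G g u = \<one>\<^bsub>G\<^esub> \<and> ?h u \<noteq> \<one>\<^bsub>G\<^esub>")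
    case True
    have "word_eval G (restrict g S) \<in> ?I"
      using True g G.word_eval_restrict[OF cF] by fastforce
    from w(3)[OF this] show ?thesis using G.word_eval_restrict[OF cF[OF w(1)], of g] by simp
  next
    case False
    then obtain \<phi> where "\<phi> \<in> auto G" "word_eval G g w = \<phi> c"
      using auto_of_kernel_subset[OF group_free_group G.is_group G(3)
          G.word_eval_hom[OF g\<^sub>0(1)] G.word_eval_surj[OF g\<^sub>0] G.word_eval_hom[OF g]] w(1,2) by blast
    then show ?thesis by (auto simp: orbit_def AutoGroup_def)
  qed
  moreover have "\<one>\<^bsub>G\<^esub> \<in> (\<lambda>g. word_eval G g w) ` (S \<rightarrow> carrier G)"
    using G.word_eval_one[of w] by (intro image_eqI[of _ _ "\<lambda>_. \<one>\<^bsub>G\<^esub>"]) auto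
  moreover have "\<phi> c \<in> (\<lambda>g. word_eval G g w) ` (S \<rightarrow> carrier G)" if "\<phi> \<in> auto G" for \<phi>
  proof (intro image_eqI)
    have \<phi>: "\<phi> \<in> hom G G" using that by (simp add: auto_def)
    show "\<phi> c = word_eval G (\<phi> \<circ> g\<^sub>0) w"
      using G.word_eval_auto[OF \<phi> g\<^sub>0(1) cF[OF w(1)]] w(2) by simp
    show "\<phi> \<circ> g\<^sub>0 \<in> S \<rightarrow> carrier G" using \<phi> g\<^sub>0(1) by (auto simp: hom_def)
  qed
  ultimately have "(\<lambda>g. word_eval G g w) ` (S \<rightarrow> carrier G) = insert \<one>\<^bsub>G\<^esub> (orbit (AutoGroup G) (\<lambda>\<phi>. \<phi>) c)"
    by (auto simp: orbit_def AutoGroup_def)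
  with w(1) show ?thesis by blast
qed

section \<open>Automorphism orbits\<close>

lemma (in group) ord_auto:
  assumes "\<phi> \<in> auto G" "x \<in> carrier G"
  shows "ord (\<phi> x) = ord x"
proof -
  interpret \<phi>: group_hom G G \<phi>
    using assms(1) by unfold_locales (simp add: auto_def)
  have inj: "inj_on \<phi> (carrier G)" using assms(1) by (simp add: auto_def Bij_def bij_betw_def)
  have "\<phi> x [^] n = \<one> \<longleftrightarrow> x [^] n = \<one>" for n :: nat
    using inj_on_eq_iff[OF inj, of "x [^] n" \<one>] assms(2) by (simp add: \<phi>.hom_nat_pow)
  then have "\<phi> x [^] n = \<one> \<longleftrightarrow> ord x dvd n" for n :: nat
    using pow_eq_id[OF assms(2)] by simp
  then show ?thesis using ord_unique assms(2) by simp
qed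

text \<open>If \<open>x\<close> conjugates \<open>c\<close> to its inverse, then \<open>inv (\<phi> c)\<close> is the image of \<open>c\<close> under conjugation by
  \<open>x\<close> followed by \<open>\<phi>\<close>.\<close>

lemma (in group) orbit_auto_inv:
  assumes c: "c \<in> carrier G" and x: "x \<in> carrier G" and real: "x \<otimes> c \<otimes> inv x = inv c"
    and y: "y \<in> orbit (AutoGroup G) (\<lambda>\<phi>. \<phi>) c"
  shows "inv y \<in> orbit (AutoGroup G) (\<lambda>\<phi>. \<phi>) c"
proof -
  obtain \<phi> where \<phi>: "\<phi> \<in> auto G" "y = \<phi> c"
    using y by (auto simp: orbit_def AutoGroup_def)
  interpret \<phi>: group_hom G G \<phi>
    using \<phi>(1) by unfold_locales (simp add: auto_def)
  define \<psi> where "\<psi> = restrict (\<phi> \<circ> (\<lambda>z. x \<otimes> z \<otimes> inv x)) (carrier G)"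
  have cancel: "inv x \<otimes> (x \<otimes> z) = z" "x \<otimes> (inv x \<otimes> z) = z" if "z \<in> carrier G" for z
    using x that by (simp_all flip: m_assoc)
  have "bij_betw (\<phi> \<circ> (\<lambda>z. x \<otimes> z \<otimes> inv x)) (carrier G) (carrier G)"
  proof (rule bij_betw_trans)
    show "bij_betw (\<lambda>z. x \<otimes> z \<otimes> inv x) (carrier G) (carrier G)"
      by (rule bij_betw_byWitness[where f' = "\<lambda>z. inv x \<otimes> z \<otimes> x"])
        (use x in \<open>auto simp: m_assoc cancel\<close>)
    show "bij_betw \<phi> (carrier G) (carrier G)" using \<phi>(1) by (simp add: auto_def Bij_def)
  qed
  then have "\<psi> \<in> Bij (carrier G)"
    unfolding \<psi>_def Bij_def by (simp cong: bij_betw_cong)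
  moreover have "\<psi> \<in> hom G G"
  proof (rule homI)
    fix u v assume uv: "u \<in> carrier G" "v \<in> carrier G"
    then have "x \<otimes> (u \<otimes> v) \<otimes> inv x = (x \<otimes> u \<otimes> inv x) \<otimes> (x \<otimes> v \<otimes> inv x)"
      using x by (simp add: m_assoc cancel)
    then show "\<psi> (u \<otimes> v) = \<psi> u \<otimes> \<psi> v"
      using x uv by (simp add: \<psi>_def del: \<phi>.hom_mult flip: \<phi>.hom_mult)
  qed (use x in \<open>simp add: \<psi>_def\<close>)
  ultimately have "\<psi> \<in> auto G" by (simp add: auto_def)
  moreover have "inv y = \<psi> c" using c real by (simp add: \<psi>_def \<phi>(2))
  ultimately show ?thesis by (auto simp: orbit_def AutoGroup_def)
qed

section \<open>Finite fields of characteristic two\<close>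

lemma CARD_power_2_imp_char_2:
  assumes "CARD('a::{field,finite}) = 2 ^ k"
  shows "(2::'a) = 0"
proof -
  have "of_nat (2 ^ k) = (0::'a)"
    using CHAR_dvd_CARD[where 'a = 'a] by (simp only: assms of_nat_eq_0_iff_char_dvd)
  then show ?thesis by simp
qed

lemma uminus_char_2:
  assumes "(2::'a::ring_1) = 0"
  shows "- x = (x::'a)"
  using assms by (metis add_eq_0_iff mult_2 mult_zero_left)

lemma square_eq_one_char_2:
  assumes "(2::'a::idom) = 0" "x\<^sup>2 = (1::'a)"
  shows "x = 1"
  using assms(2) uminus_char_2[OF assms(1)] by (auto simp: power2_eq_1_iff)

text \<open>In characteristic two squaring is injective, because \<open>x\<close> and \<open>-x\<close> coincide.\<close>

lemma square_surj_char_2: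
  assumes "(2::'a::{field,finite}) = 0"
  shows "\<exists>s. s\<^sup>2 = (x::'a)"
proof -
  have "inj (\<lambda>s::'a. s\<^sup>2)"
    by (rule injI) (metis uminus_char_2[OF assms] power2_eq_iff)
  then have "surj (\<lambda>s::'a. s\<^sup>2)" by (simp add: finite_UNIV_inj_surj)
  then show ?thesis by (metis surjD)
qed

text \<open>The cyclicity of the multiplicative group of a finite field, carried over from records to the type
  class; the last property determines the order of the generator and thereby yields roots of unity.\<close>

lemma primitive_element:
  obtains l :: "'a::{field,finite}" where "l \<noteq> 0" "\<And>x. x \<noteq> 0 \<Longrightarrow> \<exists>k. x = l ^ k"
    "\<And>k. l ^ k = 1 \<longleftrightarrow> (CARD('a) - 1) dvd k"
proof -
  let ?R = "ring_of_type_algebra :: 'a ring"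
  interpret R: field ?R by (rule field_from_type_algebra)
  interpret M: group "Multiplicative_Group.mult_of ?R" by (rule R.field_mult_group)
  have pow: "x [^]\<^bsub>Multiplicative_Group.mult_of ?R\<^esub> (k::nat) = x ^ k" for x k
    by (induction k) (simp_all add: ring_of_type_algebra_def nat_pow_def mult.commute)
  have powR: "x [^]\<^bsub>?R\<^esub> (k::nat) = x ^ k" for x k
    by (induction k) (simp_all add: ring_of_type_algebra_def nat_pow_def mult.commute)
  obtain l where l: "l \<in> carrier (Multiplicative_Group.mult_of ?R)" "carrier (Multiplicative_Group.mult_of ?R) = {l [^]\<^bsub>?R\<^esub> i |i::nat. i \<in> UNIV}"
    using R.finite_field_mult_group_has_gen by (auto simp: ring_of_type_algebra_def)
  have l': "carrier (Multiplicative_Group.mult_of ?R) = {l ^ i |i::nat. i \<in> UNIV}"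
    using l(2) unfolding powR .
  have car: "carrier (Multiplicative_Group.mult_of ?R) = UNIV - {0}" by (auto simp: ring_of_type_algebra_def)
  then have fin: "finite (carrier (Multiplicative_Group.mult_of ?R))" by simp
  have "carrier (Multiplicative_Group.mult_of ?R) = (\<lambda>i. l [^]\<^bsub>Multiplicative_Group.mult_of ?R\<^esub> i) ` {0..M.ord l - 1}"
    using M.ord_elems[OF fin l(1)] l' by (auto simp: pow)
  then have "Coset.order (Multiplicative_Group.mult_of ?R) = M.ord l"
    using M.ord_inj[OF l(1)] M.ord_ge_1[OF fin l(1)] by (simp add: Coset.order_def card_image)
  then have ord: "M.ord l = CARD('a) - 1"
    using card_Diff_singleton[of "0::'a" UNIV] unfolding Coset.order_def car by simp
  have one: "\<one>\<^bsub>Multiplicative_Group.mult_of ?R\<^esub> = 1" by (simp add: ring_of_type_algebra_def)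
  show ?thesis
  proof
    show "l \<noteq> 0" using l(1) unfolding car by simp
    show "\<exists>k. x = l ^ k" if "x \<noteq> 0" for x
      using that l' car by blast
    show "l ^ k = 1 \<longleftrightarrow> (CARD('a) - 1) dvd k" for k
      using M.pow_eq_id[OF l(1), of k] by (simp only: pow one ord)
  qed
qed

lemma exists_non_zero_one:
  assumes "CARD('a::{field,finite}) > 2"
  obtains l :: "'a::{field,finite}" where "l \<noteq> 0" "l \<noteq> 1"
proof -
  have "\<not> UNIV \<subseteq> {0, 1::'a}"
    using assms card_mono[of "{0, 1::'a}" UNIV] by auto
  with that show ?thesis by blast
qed

section \<open>Two-by-two matrices and transvections\<close>

definition mat2 :: "'a \<Rightarrow> 'a \<Rightarrow> 'a \<Rightarrow> 'a \<Rightarrow> 'a::zero^2^2" where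
  "mat2 a b c d = vector [vector [a, b], vector [c, d]]"

lemma mat2_eq_iff [simp]: "mat2 a b c d = mat2 a' b' c' d' \<longleftrightarrow> a = a' \<and> b = b' \<and> c = c' \<and> d = d'"
  by (auto simp: mat2_def vec_eq_iff forall_2)

lemma mat2_exhaust: obtains a b c d where "A = mat2 a b c d"
proof
  show "A = mat2 (A $ 1 $ 1) (A $ 1 $ 2) (A $ 2 $ 1) (A $ 2 $ 2)"
    by (simp add: mat2_def vec_eq_iff forall_2)
qed

lemma SL2_one: "\<one>\<^bsub>SL2 TYPE('a::field)\<^esub> = mat2 1 0 0 1"
  by (simp add: SL2_def mat2_def vec_eq_iff forall_2 mat_def)

lemma SL2_mult:
  "mat2 a b c d \<otimes>\<^bsub>SL2 TYPE('a::field)\<^esub> mat2 a' b' c' d' =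
     mat2 (a * a' + b * c') (a * b' + b * d') (c * a' + d * c') (c * b' + d * d')"
  by (simp add: SL2_def mat2_def vec_eq_iff forall_2 matrix_matrix_mult_def sum_2)

lemma SL2_carrier: "mat2 a b c d \<in> carrier (SL2 TYPE('a::field)) \<longleftrightarrow> a * d - b * c = 1"
  by (simp add: SL2_def mat2_def det_2)

lemma SL2_inv:
  assumes "a * d - b * c = (1::'a::field)"
  shows "inv\<^bsub>SL2 TYPE('a)\<^esub> mat2 a b c d = mat2 d (-b) (-c) a"
proof -
  interpret group "SL2 TYPE('a)" by (rule group_SL2)
  show ?thesis
    by (rule inv_equality) (use assms in \<open>simp_all add: SL2_one SL2_mult SL2_carrier algebra_simps\<close>)
qed

lemmas SL2_simps = SL2_one SL2_mult SL2_carrier SL2_inv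

lemma mat2_upper_lower_upper:
  assumes "c \<noteq> 0" "a * d - b * c = (1::'a::field)"
  shows "mat2 a b c d = mat2 1 ((a - 1) / c) 0 1 \<otimes>\<^bsub>SL2 TYPE('a)\<^esub>
           (mat2 1 0 c 1 \<otimes>\<^bsub>SL2 TYPE('a)\<^esub> mat2 1 ((d - 1) / c) 0 1)"
proof -
  have "b = (a * d - 1) / c" using assms by (simp add: field_simps)
  then show ?thesis unfolding \<open>b = _\<close> using assms(1) by (simp add: SL2_mult field_simps)
qed

text \<open>The transvections generate: a matrix with nonzero lower left entry is a product of three of them,
  and adding the first row to the second makes that entry nonzero if it was zero.\<close>

lemma subgroup_SL2_eqI:
  assumes H: "subgroup H (SL2 TYPE('a::field))"
    and U: "\<And>x. mat2 1 x 0 1 \<in> H" and L: "\<And>x. mat2 1 0 x 1 \<in> H"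
  shows "H = carrier (SL2 TYPE('a))"
proof
  show "H \<subseteq> carrier (SL2 TYPE('a))" using H by (rule subgroup.subset)
  have *: "mat2 a b c d \<in> H" if "c \<noteq> 0" "a * d - b * c = 1" for a b c d
    unfolding mat2_upper_lower_upper[OF that]
    by (intro subgroup.m_closed[OF H] U L)
  show "carrier (SL2 TYPE('a)) \<subseteq> H"
  proof
    fix A assume A: "A \<in> carrier (SL2 TYPE('a))"
    obtain a b c d where A_eq: "A = mat2 a b c d" by (rule mat2_exhaust)
    with A have det: "a * d - b * c = 1" by (simp add: SL2_carrier)
    show "A \<in> H"
    proof (cases "c = 0")
      case False
      with det * show ?thesis by (simp add: A_eq)
    next
      case True
      with det have "a \<noteq> 0" by auto
      then have "mat2 a b a (b + d) \<in> H"
        using det True by (intro *) (auto simp: algebra_simps)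
      from subgroup.m_closed[OF H L[of "-1"] this] show ?thesis
        by (simp add: A_eq SL2_mult True)
    qed
  qed
qed

lemma SL2_conj_diag:
  assumes "s \<noteq> (0::'a::field)"
  shows "mat2 s 0 0 (1/s) \<otimes>\<^bsub>SL2 TYPE('a)\<^esub> mat2 1 x 0 1 \<otimes>\<^bsub>SL2 TYPE('a)\<^esub> inv\<^bsub>SL2 TYPE('a)\<^esub> mat2 s 0 0 (1/s)
           = mat2 1 (s\<^sup>2 * x) 0 1"
  using assms by (simp add: SL2_simps power2_eq_square)

text \<open>Conjugation by this matrix exchanges upper and lower transvections, and it is the inverse
  transpose on all of \<open>SL\<^sub>2\<close>.\<close>

lemma SL2_conj_swap:
  "mat2 0 1 (-1) 0 \<otimes>\<^bsub>SL2 TYPE('a::field)\<^esub> mat2 a b c d \<otimes>\<^bsub>SL2 TYPE('a)\<^esub> inv\<^bsub>SL2 TYPE('a)\<^esub> mat2 0 1 (-1) 0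
     = mat2 d (-c) (-b) a"
  by (simp add: SL2_simps)

section \<open>Simplicity and generation of the special linear group\<close>

text \<open>Conjugating by diagonal matrices multiplies the parameter of a transvection by any nonzero square,
  and in characteristic two every field element is a square.\<close>

lemma normal_SL2_transvection:
  assumes char: "(2::'a::{field,finite}) = 0"
    and N: "N \<lhd> SL2 TYPE('a)" and x: "mat2 1 x 0 1 \<in> N" "x \<noteq> 0"
  shows "N = carrier (SL2 TYPE('a))"
proof (rule subgroup_SL2_eqI)
  show "subgroup N (SL2 TYPE('a))" using N by (rule normal_imp_subgroup)
  have conj: "A \<otimes>\<^bsub>SL2 TYPE('a)\<^esub> B \<otimes>\<^bsub>SL2 TYPE('a)\<^esub> inv\<^bsub>SL2 TYPE('a)\<^esub> A \<in> N"
    if "A \<in> carrier (SL2 TYPE('a))" "B \<in> N" for A B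
    using normal.inv_op_closed2[OF N that] .
  show U: "mat2 1 y 0 1 \<in> N" for y
  proof (cases "y = 0")
    case True
    then show ?thesis
      using subgroup.one_closed[OF normal_imp_subgroup[OF N]] by (simp add: SL2_one)
  next
    case False
    obtain s where s: "s\<^sup>2 = y / x" using square_surj_char_2[OF char] by blast
    with False x(2) have "s \<noteq> 0" by auto
    then have "mat2 s 0 0 (1/s) \<in> carrier (SL2 TYPE('a))" by (simp add: SL2_carrier)
    from conj[OF this x(1)] show ?thesis
      using x(2) by (simp add: SL2_conj_diag[OF \<open>s \<noteq> 0\<close>] s)
  qed
  have "mat2 0 1 (-1) 0 \<in> carrier (SL2 TYPE('a))" by (simp add: SL2_carrier)
  from conj[OF this U] show "mat2 1 0 y 1 \<in> N" for y
    using SL2_conj_swap[of 1 "-y" 0 1] by (metis minus_minus minus_zero)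
qed

text \<open>A nontrivial element that is triangular can be conjugated out of triangular form. A diagonal one
  needs distinct diagonal entries for this; they are distinct because \<open>1\<close> is the only scalar matrix
  in \<open>SL\<^sub>2\<close> in characteristic two.\<close>

lemma SL2_nontrivial_conj_lower_left:
  assumes char: "(2::'a::field) = 0"
    and N: "N \<lhd> SL2 TYPE('a)" and g: "g \<in> N" "g \<noteq> \<one>\<^bsub>SL2 TYPE('a)\<^esub>"
  obtains a b c d where "mat2 a b c d \<in> N" "c \<noteq> 0"
proof -
  note conj = normal.inv_op_closed2[OF N]
  obtain a b c d where g_eq: "g = mat2 a b c d" by (rule mat2_exhaust)
  have det: "a * d - b * c = 1"
    using g(1) subgroup.subset[OF normal_imp_subgroup[OF N]] by (auto simp: g_eq SL2_carrier)
  consider "c \<noteq> 0" | "c = 0" "b \<noteq> 0" | "c = 0" "b = 0" by blast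
  then show ?thesis
  proof cases
    case 1
    with g(1) that show ?thesis by (simp add: g_eq)
  next
    case 2
    have "mat2 0 1 (-1) 0 \<in> carrier (SL2 TYPE('a))" by (simp add: SL2_carrier)
    from conj[OF this g(1)] have "mat2 d (-c) (-b) a \<in> N"
      by (simp add: g_eq SL2_conj_swap)
    with 2 that show ?thesis by simp
  next
    case 3
    with det have ad: "a * d = 1" by simp
    have "a \<noteq> d"
    proof
      assume "a = d"
      with ad have "a = 1" using square_eq_one_char_2[OF char, of a] by (simp add: power2_eq_square)
      with \<open>a = d\<close> 3 g(2) show False by (simp add: g_eq SL2_one)
    qed
    have "mat2 1 0 1 1 \<in> carrier (SL2 TYPE('a))" by (simp add: SL2_carrier)
    from conj[OF this g(1)] have "mat2 a 0 (a - d) d \<in> N"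
      by (simp add: g_eq SL2_simps 3)
    with \<open>a \<noteq> d\<close> that show ?thesis by simp
  qed
qed

text \<open>From a matrix with nonzero lower left entry in \<open>N\<close>, three reductions inside \<open>N\<close> produce a
  transvection. Conjugation clears the upper left entry; the commutator of the result \<open>k\<close> with a diagonal
  matrix \<open>s\<close> is a triangular matrix \<open>h\<close> with diagonal \<open>(l\<^sup>-\<^sup>2, l\<^sup>2)\<close>; and the commutator of \<open>h\<close>
  with a lower transvection \<open>u\<close> is again a lower transvection, with parameter \<open>l\<^sup>4 - 1\<close>. The latter is
  nonzero because \<open>l \<noteq> 1\<close> and squaring is injective.\<close>

lemma simple_group_SL2:
  assumes char: "(2::'a::{field,finite}) = 0" and card: "CARD('a) > 2"
  shows "simple_group (SL2 TYPE('a))"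
proof -
  let ?G = "SL2 TYPE('a)"
  interpret group ?G by (rule group_SL2)
  show ?thesis
  proof
    have "mat2 1 1 0 1 \<in> carrier ?G" "\<one>\<^bsub>?G\<^esub> \<in> carrier ?G" "mat2 1 1 0 1 \<noteq> \<one>\<^bsub>?G\<^esub>"
      by (simp_all add: SL2_simps)
    moreover have "finite (carrier ?G)" by simp
    ultimately have "\<not> card (carrier ?G) \<le> Suc 0"
      using card_le_Suc0_iff_eq by blast
    then show "1 < Coset.order ?G" by (simp add: Coset.order_def)
  next
    fix N assume N: "N \<lhd> ?G"
    then have subN: "subgroup N ?G" by (rule normal_imp_subgroup)
    show "N = carrier ?G \<or> N = {\<one>\<^bsub>?G\<^esub>}"
    proof (cases "N \<subseteq> {\<one>\<^bsub>?G\<^esub>}")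
      case True
      then show ?thesis using subgroup.one_closed[OF subN] by blast
    next
      case False
      then obtain a b c d where g: "mat2 a b c d \<in> N" and c: "c \<noteq> 0"
        using SL2_nontrivial_conj_lower_left[OF char N] by blast
      have det: "a * d - b * c = 1"
        using g subgroup.subset[OF subN] by (auto simp: SL2_carrier)
      note conj = normal.inv_op_closed2[OF N]
      obtain l :: 'a where l: "l \<noteq> 0" "l \<noteq> 1" using exists_non_zero_one[OF card] .
      define e where "e = a + d"
      define k where "k = mat2 0 (-1/c) c e"
      have b: "b = (a * d - 1) / c" using det c by (simp add: field_simps)
      have "mat2 1 (-a/c) 0 1 \<otimes>\<^bsub>?G\<^esub> mat2 a b c d \<otimes>\<^bsub>?G\<^esub> inv\<^bsub>?G\<^esub> mat2 1 (-a/c) 0 1 = k"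
        unfolding k_def e_def b using c by (simp add: SL2_simps field_simps)
      moreover have "mat2 1 (-a/c) 0 1 \<in> carrier ?G" by (simp add: SL2_carrier)
      ultimately have k: "k \<in> N" using conj[OF _ g] by metis
      define s where "s = mat2 l 0 0 (1/l)"
      have s: "s \<in> carrier ?G" using l by (simp add: s_def SL2_carrier)
      define r where "r = c * e * (1 - 1 / l\<^sup>2)"
      define h where "h = mat2 (1/l\<^sup>2) 0 r (l\<^sup>2)"
      have "k \<otimes>\<^bsub>?G\<^esub> (s \<otimes>\<^bsub>?G\<^esub> inv\<^bsub>?G\<^esub> k \<otimes>\<^bsub>?G\<^esub> inv\<^bsub>?G\<^esub> s) = h"
        using c l by (simp add: h_def r_def s_def k_def SL2_simps field_simps power2_eq_square)
      then have h: "h \<in> N"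
        using subgroup.m_closed[OF subN k conj[OF s subgroup.m_inv_closed[OF subN k]]] by simp
      define u where "u = mat2 1 0 1 (1::'a)"
      have u: "u \<in> carrier ?G" by (simp add: u_def SL2_carrier)
      have "h \<otimes>\<^bsub>?G\<^esub> (u \<otimes>\<^bsub>?G\<^esub> inv\<^bsub>?G\<^esub> h \<otimes>\<^bsub>?G\<^esub> inv\<^bsub>?G\<^esub> u) = mat2 1 0 (l ^ 4 - 1) 1"
        using l by (simp add: h_def u_def SL2_simps field_simps power2_eq_square power4_eq_xxxx)
      then have "mat2 1 0 (l ^ 4 - 1) 1 \<in> N"
        using subgroup.m_closed[OF subN h conj[OF u subgroup.m_inv_closed[OF subN h]]] by simp
      moreover have "mat2 0 1 (-1) 0 \<in> carrier ?G" by (simp add: SL2_carrier)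
      ultimately have "mat2 1 (1 - l ^ 4) 0 1 \<in> N"
        using conj[of "mat2 0 1 (-1) 0" "mat2 1 0 (l ^ 4 - 1) 1"] by (simp add: SL2_conj_swap)
      moreover have "1 - l ^ 4 \<noteq> 0"
      proof
        assume "1 - l ^ 4 = 0"
        then have "(l\<^sup>2)\<^sup>2 = 1" by simp
        then have "l\<^sup>2 = 1" by (rule square_eq_one_char_2[OF char])
        then have "l = 1" by (rule square_eq_one_char_2[OF char])
        with l(2) show False by simp
      qed
      ultimately have "N = carrier ?G" by (rule normal_SL2_transvection[OF char N])
      then show ?thesis ..
    qed
  qed
qed

lemma not_comm_group_SL2: "\<not> comm_group (SL2 TYPE('a::field))"
proof
  assume "comm_group (SL2 TYPE('a))"
  then interpret comm_group "SL2 TYPE('a)" .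
  have "mat2 1 1 0 1 \<otimes>\<^bsub>SL2 TYPE('a)\<^esub> mat2 1 0 1 1 = mat2 1 0 1 1 \<otimes>\<^bsub>SL2 TYPE('a)\<^esub> mat2 1 1 0 1"
    by (rule m_comm) (simp_all add: SL2_carrier)
  then have "1 + 1 = (1::'a)" by (simp add: SL2_mult del: one_add_one)
  then show False by (metis add_cancel_right_right one_neq_zero)
qed

text \<open>The second generator \<open>b\<close> is an upper transvection with parameter \<open>1\<close> times the matrix that swaps the two
  coordinates up to sign. The latter inverts the diagonal generator \<open>a\<close>, so \<open>b a b\<^sup>-\<^sup>1 a\<close> is a commutator
  of \<open>a\<close> with a transvection, hence a transvection itself, with parameter \<open>1 - l\<^sup>-\<^sup>2\<close>.
  Conjugating it by powers of \<open>a\<close> gives all upper transvections, because every field element is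
  a square and every nonzero one is a power of \<open>l\<close>. Dividing \<open>b\<close> by a transvection recovers the swap, which
  turns upper transvections into lower ones.\<close>

lemma generate_SL2:
  assumes char: "(2::'a::{field,finite}) = 0" and card: "CARD('a) > 2"
    and l: "l \<noteq> 0" "\<And>x. x \<noteq> 0 \<Longrightarrow> \<exists>k. x = (l::'a) ^ k"
  shows "generate (SL2 TYPE('a)) {mat2 l 0 0 (1/l), mat2 (-1) 1 (-1) 0} = carrier (SL2 TYPE('a))"
    (is "generate ?G {?a, ?b} = _")
proof (rule subgroup_SL2_eqI)
  interpret group ?G by (rule group_SL2)
  let ?H = "generate ?G {?a, ?b}"
  have gens: "{?a, ?b} \<subseteq> carrier ?G" using l(1) by (simp add: SL2_carrier)
  show H: "subgroup ?H ?G" by (rule generate_is_subgroup[OF gens])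
  have a: "?a \<in> ?H" and b: "?b \<in> ?H" by (auto intro: generate.incl)
  define x where "x = 1 - 1 / l\<^sup>2"
  have "?b \<otimes>\<^bsub>?G\<^esub> ?a \<otimes>\<^bsub>?G\<^esub> inv\<^bsub>?G\<^esub> ?b \<otimes>\<^bsub>?G\<^esub> ?a = mat2 1 x 0 1"
    using l(1) by (simp add: SL2_simps x_def field_simps power2_eq_square)
  then have x: "mat2 1 x 0 1 \<in> ?H"
    by (metis a b subgroup.m_closed[OF H] subgroup.m_inv_closed[OF H])
  have "x \<noteq> 0"
  proof
    assume "x = 0"
    then have "l\<^sup>2 = 1" using l(1) by (simp add: x_def field_simps)
    then have "l = 1" by (rule square_eq_one_char_2[OF char])
    then have "y = 0 \<or> y = 1" for y :: 'a using l(2) by auto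
    with exists_non_zero_one[OF card] show False by metis
  qed
  have diag: "mat2 (l ^ k) 0 0 (1 / l ^ k) \<in> ?H" for k
  proof (induction k)
    case 0
    then show ?case using generate.one[of ?G] by (simp add: SL2_one)
  next
    case (Suc k)
    from subgroup.m_closed[OF H a this] show ?case by (simp add: SL2_mult)
  qed
  show U: "mat2 1 y 0 1 \<in> ?H" for y
  proof (cases "y = 0")
    case True
    then show ?thesis using generate.one[of ?G] by (simp add: SL2_one)
  next
    case False
    obtain s where s: "s\<^sup>2 = y / x" using square_surj_char_2[OF char] by blast
    with False \<open>x \<noteq> 0\<close> have "s \<noteq> 0" by auto
    then have "mat2 s 0 0 (1/s) \<in> ?H" using l(2) diag by metis
    then have "mat2 s 0 0 (1/s) \<otimes>\<^bsub>?G\<^esub> mat2 1 x 0 1 \<otimes>\<^bsub>?G\<^esub> inv\<^bsub>?G\<^esub> mat2 s 0 0 (1/s) \<in> ?H"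
      by (intro subgroup.m_closed[OF H] subgroup.m_inv_closed[OF H] x)
    then show ?thesis
      using \<open>x \<noteq> 0\<close> by (simp add: SL2_conj_diag[OF \<open>s \<noteq> 0\<close>] s)
  qed
  have "mat2 1 (-1) 0 1 \<otimes>\<^bsub>?G\<^esub> ?b = mat2 0 1 (-1) 0" by (simp add: SL2_mult)
  then have J: "mat2 0 1 (-1) 0 \<in> ?H" using subgroup.m_closed[OF H U b] by metis
  show "mat2 1 0 y 1 \<in> ?H" for y
  proof -
    have "mat2 0 1 (-1) 0 \<otimes>\<^bsub>?G\<^esub> mat2 1 (-y) 0 1 \<otimes>\<^bsub>?G\<^esub> inv\<^bsub>?G\<^esub> mat2 0 1 (-1) 0 \<in> ?H"
      by (intro subgroup.m_closed[OF H] subgroup.m_inv_closed[OF H] J U)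
    then show ?thesis by (simp add: SL2_conj_swap)
  qed
qed

section \<open>An element of order seventeen\<close>

text \<open>Over the field with two elements, the primitive fifth roots of unity are the roots of
  \<open>x\<^sup>4 + x\<^sup>3 + x\<^sup>2 + x + 1\<close>, and four of the eight values \<open>\<zeta> + \<zeta>\<^sup>-\<^sup>1\<close>, for \<open>\<zeta>\<close> of order \<open>17\<close>, are such
  roots. The matrix here is the companion matrix of \<open>x\<^sup>2 + t x + 1\<close>, with eigenvalues \<open>\<zeta>\<close> and
  \<open>\<zeta>\<^sup>-\<^sup>1\<close>. Its seventeenth power is computed by repeated squaring.\<close>

lemma ord_17_SL2:
  assumes char: "(2::'a::field) = 0" and t: "t ^ 5 = 1" "(t::'a) \<noteq> 1"
  shows "group.ord (SL2 TYPE('a)) (mat2 0 1 1 t) = 17"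
proof -
  let ?G = "SL2 TYPE('a)" and ?c = "mat2 0 1 1 t"
  interpret group ?G by (rule group_SL2)
  note neg = uminus_char_2[OF char]
  \<comment> \<open>Together with \<open>t4\<close> below, these rules reduce every polynomial in \<open>t\<close> to its normal form in the basis \<open>1, t, t\<^sup>2, t\<^sup>3\<close> modulo two.\<close>
  have dbl: "x + x = 0" "x + (x + y) = y" for x y :: 'a
    using neg by (metis add.right_inverse, metis add_minus_cancel)
  have c: "?c \<in> carrier ?G" by (simp add: SL2_carrier neg)
  have "(t - 1) * (t ^ 4 + t ^ 3 + t\<^sup>2 + t + 1) = t ^ 5 - 1"
    by (simp add: algebra_simps eval_nat_numeral)
  with t have "t ^ 4 + (t ^ 3 + t\<^sup>2 + t + 1) = 0" by (simp add: add.assoc)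
  then have "t ^ 4 = t ^ 3 + t\<^sup>2 + t + 1" using neg by (metis add_eq_0_iff)
  then have t4: "t * (t * (t * t)) = 1 + (t + (t * t + t * (t * t)))"
    by (simp add: eval_nat_numeral ac_simps)
  have sq: "?c [^]\<^bsub>?G\<^esub> (2 * k) = ?c [^]\<^bsub>?G\<^esub> k \<otimes>\<^bsub>?G\<^esub> ?c [^]\<^bsub>?G\<^esub> k" for k :: nat
    using nat_pow_mult[OF c, of k k] by (simp add: mult_2)
  have c1: "?c [^]\<^bsub>?G\<^esub> (1::nat) = ?c" using c by simp
  have c2: "?c [^]\<^bsub>?G\<^esub> (2::nat) = mat2 1 t t (1 + t * t)"
    using sq[of 1] c1 by (simp add: SL2_mult)
  have c4: "?c [^]\<^bsub>?G\<^esub> (4::nat) = mat2 (1 + t * t) (t * (t * t)) (t * (t * t)) (t + t * (t * t))"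
    using sq[of 2] by (simp add: c2 SL2_mult algebra_simps dbl t4)
  have c8: "?c [^]\<^bsub>?G\<^esub> (8::nat) = mat2 (t * t + t * (t * t)) (t * t) (t * t) (t * t)"
    using sq[of 4] by (simp add: c4 SL2_mult algebra_simps dbl t4)
  have c16: "?c [^]\<^bsub>?G\<^esub> (16::nat) = mat2 t 1 1 0"
    using sq[of 8] by (simp add: c8 SL2_mult algebra_simps dbl t4)
  have "?c [^]\<^bsub>?G\<^esub> (17::nat) = ?c [^]\<^bsub>?G\<^esub> (16::nat) \<otimes>\<^bsub>?G\<^esub> ?c"
    using nat_pow_mult[OF c, of 16 1] c1 by simp
  then have "?c [^]\<^bsub>?G\<^esub> (17::nat) = \<one>\<^bsub>?G\<^esub>" by (simp add: c16 SL2_mult SL2_one dbl)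
  then have "ord ?c dvd 17" using pow_eq_id[OF c] by blast
  moreover have "normalization_semidom_class.prime (17::nat)" by simp
  moreover have "ord ?c \<noteq> 1" using ord_eq_1[OF c] by (simp add: SL2_one)
  ultimately show ?thesis unfolding prime_nat_iff by blast
qed

text \<open>The matrix is symmetric, so its inverse transpose is its inverse.\<close>

lemma SL2_inv_conj_swap:
  assumes "(2::'a::field) = 0"
  shows "mat2 0 1 (-1) 0 \<otimes>\<^bsub>SL2 TYPE('a)\<^esub> mat2 0 1 1 t \<otimes>\<^bsub>SL2 TYPE('a)\<^esub> inv\<^bsub>SL2 TYPE('a)\<^esub> mat2 0 1 (-1) 0
     = inv\<^bsub>SL2 TYPE('a)\<^esub> mat2 0 1 1 (t::'a)"
  unfolding SL2_conj_swap using SL2_inv[of 0 t 1 1] by (simp add: uminus_char_2[OF assms])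

section \<open>The word\<close>

theorem corollary1p3:
  fixes n q :: nat
  assumes "n \<ge> 2"
    and "q = 2 ^ (2 ^ n)"
    and "CARD('a::{field,finite}) = q"
  shows "\<exists>w \<in> carrier (free_group_rank 2). \<exists>C.
           equivalence_class (SL2 TYPE('a)) C
         \<and> (\<forall>c\<in>C. group.ord (SL2 TYPE('a)) c = 17)
         \<and> word_values (SL2 TYPE('a)) 2 w = {\<one>\<^bsub>SL2 TYPE('a)\<^esub>} \<union> C"
proof -
  let ?G = "SL2 TYPE('a)"
  interpret group ?G by (rule group_SL2)
  have char: "(2::'a) = 0"
    by (rule CARD_power_2_imp_char_2[where k = "2 ^ n"]) (simp add: assms)
  obtain k where k: "n = 2 + k" using assms(1) le_Suc_ex by blast
  have q16: "q = 16 ^ (2 ^ k)" by (simp add: assms(2) k power_add power_mult)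
  then have q: "q \<ge> 16" using self_le_power[of "16::nat" "2 ^ k"] by simp
  then have card: "CARD('a) > 2" using assms(3) by simp
  have "[16 ^ (2 ^ k) = 1 ^ (2 ^ k)] (mod (5::nat))"
    by (rule cong_pow) (simp add: cong_def)
  then have "[q = 1] (mod 5)" by (simp add: q16)
  then obtain m where m: "q - 1 = 5 * m"
    using q by (metis cong_altdef_nat cong_sym dvdE le_trans one_le_numeral)
  obtain l :: 'a where l: "l \<noteq> 0" "\<And>x. x \<noteq> 0 \<Longrightarrow> \<exists>k. x = l ^ k"
    "\<And>k. l ^ k = 1 \<longleftrightarrow> (CARD('a) - 1) dvd k"
    using primitive_element by blast
  \<comment> \<open>A primitive fifth root of unity, as \<open>l\<close> has order \<open>5 m\<close>.\<close>
  define t where "t = l ^ m"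
  have "t ^ 5 = 1" using l(3)[of "m * 5"] m by (simp add: t_def assms(3) power_mult mult.commute)
  have "m > 0" using m q by (cases m) auto
  then have "t \<noteq> 1" using l(3)[of m] m by (auto simp: t_def assms(3) dest: dvd_imp_le)
  define c where "c = mat2 0 1 1 t"
  have c: "c \<in> carrier ?G" by (simp add: c_def SL2_carrier uminus_char_2[OF char])
  let ?C = "orbit (AutoGroup ?G) (\<lambda>\<phi>. \<phi>) c"
  have invC: "inv\<^bsub>?G\<^esub> y \<in> ?C" if "y \<in> ?C" for y
  proof (rule orbit_auto_inv[OF c _ _ that])
    show "mat2 0 1 (-1) 0 \<in> carrier ?G" by (simp add: SL2_carrier)
    show "mat2 0 1 (-1) 0 \<otimes>\<^bsub>?G\<^esub> c \<otimes>\<^bsub>?G\<^esub> inv\<^bsub>?G\<^esub> mat2 0 1 (-1) 0 = inv\<^bsub>?G\<^esub> c"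
      unfolding c_def by (rule SL2_inv_conj_swap[OF char])
  qed
  have ord: "\<forall>y\<in>?C. ord y = 17"
    using ord_auto[OF _ c] ord_17_SL2[OF char \<open>t ^ 5 = 1\<close> \<open>t \<noteq> 1\<close>]
    by (auto simp: orbit_def AutoGroup_def c_def)
  define g\<^sub>0 where "g\<^sub>0 i = (if i = 0 then mat2 l 0 0 (1/l) else mat2 (-1) 1 (-1) 0)" for i :: nat
  have "g\<^sub>0 \<in> {..<2} \<rightarrow> carrier ?G" using l(1) by (auto simp: g\<^sub>0_def SL2_carrier)
  moreover have "{..<2::nat} = {0, 1}" by auto
  then have "generate ?G (g\<^sub>0 ` {..<2}) = carrier ?G"
    using generate_SL2[OF char card l(1,2)] by (simp add: g\<^sub>0_def insert_commute)
  ultimately obtain w where w: "w \<in> carrier (free_group {..<2::nat})"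
    "(\<lambda>g. word_eval ?G g w) ` ({..<2::nat} \<rightarrow> carrier ?G) = insert \<one>\<^bsub>?G\<^esub> ?C"
    using word_image_eq_orbit[OF simple_group_SL2[OF char card] not_comm_group_SL2 _ _ _ _ c, of "{..<2}" g\<^sub>0]
    by auto
  have "word_values ?G 2 w = insert \<one>\<^bsub>?G\<^esub> ?C \<union> (\<lambda>y. inv\<^bsub>?G\<^esub> y) ` insert \<one>\<^bsub>?G\<^esub> ?C"
    unfolding w(2)[symmetric] word_values_def by auto
  then have "word_values ?G 2 w = {\<one>\<^bsub>?G\<^esub>} \<union> ?C" using invC by auto
  with w(1) ord c show ?thesis
    unfolding equivalence_class_def free_group_rank_def by blast
qed

end
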